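(* Let $A,B,C\in\mathbb{R}^{n\times n}$ and define the $2n\times 2n$ matrices $$\mathcal{M}=\begin{bmatrix} BA^\top & 0\\ -CA^\top & I_n\end{bmatrix},\qquad \mathcal{L}=\begin{bmatrix} I_n & 0\\ AC^\top & AB^\top\end{bmatrix}.$$ Let $U_1,V_1,U_2,V_2\in\mathbb{C}^{n\times k}$ and $T_1,T_2\in\mathbb{C}^{k\times k}$ satisfy $$\mathcal{M}\begin{bmatrix} U_1 \\ {V_1} \end{bmatrix}=\begin{bmatrix} U_2 \\ {V_2} \end{bmatrix}T_1,\qquad \mathcal{L}\begin{bmatrix} U_1 \\ {V_1} \end{bmatrix}=\begin{bmatrix} U_2 \\ {V_2} \end{bmatrix}T_2,$$ where $\begin{bmatrix} U_i \\ {V_i} \end{bmatrix}$ has full column rank for $i=1,2$. Assume that $\sigma(BA^\top)$ is $\top$-reciprocal free. Then: 1. If $\sigma(T_1-\lambda T_2)=\sigma(I_n-\lambda AB^\top)$, then $U_1=U_2=0$. 2. If $T_1-\lambda T_2\sim BA^\top-\lambda I_n$ (so in particular $k=n$), then $U_1$ and $U_2$ are nonsingular. Moreover, if in addition $A$ is nonsingular, then $X=V_1U_1^{-1}A^{-\top}=U_2^{-\top}V_2^\top A^{-\top}$ is the unique solution of the equation $X=AX^\top B+C$.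
   Context: $\sigma(M)$ denotes the set of eigenvalues of a square matrix $M$. For a square matrix pencil $E-\lambda F$, $\sigma(E-\lambda F)$ denotes its set of generalized eigenvalues in $\mathbb{C}\cup\{\infty\}$: a finite $\lambda$ belongs to it iff $\det(E-\lambda F)=0$, and $\infty$ belongs to it iff $\det F=0$. Two pencils $E-\lambda F$ and $\widetilde E-\lambda\widetilde F$ of the same size are equivalent, written $E-\lambda F\sim\widetilde E-\lambda\widetilde F$, if there are nonsingular (constant) matrices $P,Q$ with $P(E-\lambda F)Q=\widetilde E-\lambda\widetilde F$. A set $\{\lambda_1,\dots,\lambda_m\}$ of complex numbers is $\top$-reciprocal free if $\lambda_i\neq 1/\lambda_j$ for all $i,j$ (including $i=j$), where $0$ and $\infty$ are regarded as reciprocals of each other; for finite numbers this means $\lambda_i\lambda_j\ne 1$ for all $i,j$. $M^{-\top}$ denotes $(M^{-1})^\top$, and $\top$ is the plain transpose (no conjugation) also for complex matrices. *)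

theory Defs
  imports
    Complex_Main
    "Jordan_Normal_Form.Spectral_Radius"
    "Jordan_Normal_Form.DL_Rank"
    "Jordan_Normal_Form.Gauss_Jordan_Elimination"
begin

abbreviation cmat :: "real mat \<Rightarrow> complex mat" where
  "cmat \<equiv> map_mat complex_of_real"

text \<open>Meaningful for invertible matrices only.\<close>

definition mat_inv :: "'a :: field mat \<Rightarrow> 'a mat" where
  "mat_inv A = the (mat_inverse A)"

datatype gen_eigenvalue = Finite complex | Infinite

text \<open>The pencil \<open>E - \<mu> F\<close> is represented by its two coefficient matrices \<open>E\<close> and \<open>F\<close>,
  which are meant to be square of the same size.  A singular pencil has every point of the
  extended plane in its spectrum.\<close>

definition pencil_spectrum :: "complex mat \<Rightarrow> complex mat \<Rightarrow> gen_eigenvalue set" where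
  "pencil_spectrum E F =
     {Finite \<mu> | \<mu>. det (E - \<mu> \<cdot>\<^sub>m F) = 0} \<union> (if det F = 0 then {Infinite} else {})"

text \<open>Multiplying out with \<open>P\<close> and \<open>Q\<close> preserves the size, so equivalent pencils
  necessarily have the same size.\<close>

definition pencil_equiv :: "complex mat \<Rightarrow> complex mat \<Rightarrow> complex mat \<Rightarrow> complex mat \<Rightarrow> bool" where
  "pencil_equiv E F E' F' \<longleftrightarrow>
     (\<exists>P \<in> carrier_mat (dim_row E) (dim_row E). \<exists>Q \<in> carrier_mat (dim_col E) (dim_col E).
        invertible_mat P \<and> invertible_mat Q \<and>
        (\<forall>\<mu>. P * (E - \<mu> \<cdot>\<^sub>m F) * Q = E' - \<mu> \<cdot>\<^sub>m F'))"

text \<open>For finite numbers only: the reciprocal of \<open>0\<close> is \<open>\<infinity>\<close>, which is not in \<open>S\<close>, so \<open>0 \<in> S\<close> is allowed.\<close>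

definition T_reciprocal_free :: "complex set \<Rightarrow> bool" where
  "T_reciprocal_free S \<longleftrightarrow> (\<forall>x \<in> S. \<forall>y \<in> S. x * y \<noteq> 1)"

definition M_mat :: "nat \<Rightarrow> 'a :: comm_ring_1 mat \<Rightarrow> 'a mat \<Rightarrow> 'a mat \<Rightarrow> 'a mat" where
  "M_mat n A B C = four_block_mat (B * A\<^sup>T) (0\<^sub>m n n) (- (C * A\<^sup>T)) (1\<^sub>m n)"

definition L_mat :: "nat \<Rightarrow> 'a :: comm_ring_1 mat \<Rightarrow> 'a mat \<Rightarrow> 'a mat \<Rightarrow> 'a mat" where
  "L_mat n A B C = four_block_mat (1\<^sub>m n) (0\<^sub>m n n) (A * C\<^sup>T) (A * B\<^sup>T)"

definition T_Stein_solutions :: "nat \<Rightarrow> 'a :: comm_ring_1 mat \<Rightarrow> 'a mat \<Rightarrow> 'a mat \<Rightarrow> 'a mat set" where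
  "T_Stein_solutions n A B C = {X \<in> carrier_mat n n. X = A * X\<^sup>T * B + C}"

end

theory Submission
  imports Defs
begin

text \<open>
  Write \<open>G = B A\<^sup>T\<close> and \<open>K = C A\<^sup>T\<close>.  Row by row, the two hypotheses on \<open>\<M>\<close> and \<open>\<L>\<close> say
  \<open>G U\<^sub>1 = U\<^sub>2 T\<^sub>1\<close>, \<open>V\<^sub>1 = K U\<^sub>1 + V\<^sub>2 T\<^sub>1\<close>, \<open>U\<^sub>1 = U\<^sub>2 T\<^sub>2\<close> and \<open>V\<^sub>2 T\<^sub>2 = K\<^sup>T U\<^sub>1 + G\<^sup>T V\<^sub>1\<close>.

  Every use of the spectrum goes through one fact, \<open>invariant_set_contains_eigenmatrix\<close>: a set of
  \<open>n \<times> m\<close> matrices that is stable under all maps \<open>M \<mapsto> G M - \<mu> M\<close> and contains a nonzero matrix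
  contains a nonzero \<open>M\<close> with \<open>G M = \<mu> M\<close>.  It replaces eigenvectors in invariant subspaces, and
  for \<open>m > 1\<close> it also replaces Kronecker products: the solution set of \<open>G X T\<^sub>2 = X T\<^sub>1\<close> is stable
  under \<open>X \<mapsto> G X\<close>, so a nonzero solution yields one with \<open>G X = \<mu> X\<close>, hence
  \<open>X (T\<^sub>1 - \<mu> T\<^sub>2) = 0\<close>, which is impossible if no eigenvalue of \<open>G\<close> is a root of the pencil
  \<open>T\<^sub>1 - \<lambda> T\<^sub>2\<close> (\<open>generalized_Sylvester_zero\<close>).

  For the first claim, \<open>G U\<^sub>2 T\<^sub>2 = G U\<^sub>1 = U\<^sub>2 T\<^sub>1\<close>.  The finite roots of \<open>I - \<lambda> A B\<^sup>T\<close> are the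
  reciprocals of the nonzero eigenvalues of \<open>G\<close>, so by reciprocal freeness they are not eigenvalues
  of \<open>G\<close>; by hypothesis they are also the finite roots of \<open>T\<^sub>1 - \<lambda> T\<^sub>2\<close>.  Thus \<open>U\<^sub>2 = 0\<close> and \<open>U\<^sub>1 = U\<^sub>2 T\<^sub>2 = 0\<close>.

  For the second claim, let \<open>P T\<^sub>1 Q = G\<close> and \<open>P T\<^sub>2 Q = I\<close>.  Replacing the bases by
  \<open>U\<^sub>1 Q, V\<^sub>1 Q, U\<^sub>2 P\<^sup>-\<^sup>1, V\<^sub>2 P\<^sup>-\<^sup>1\<close> turns the pencil into \<open>G - \<lambda> I\<close> and changes neither
  \<open>V\<^sub>1 U\<^sub>1\<^sup>-\<^sup>1\<close> nor \<open>V\<^sub>2 U\<^sub>2\<^sup>-\<^sup>1\<close>.  Both upper blocks become the same matrix \<open>W\<close>, which commutes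
  with \<open>G\<close>, and the lower blocks \<open>Y, Z\<close> satisfy \<open>Y = K W + Z G\<close> and \<open>Z = K\<^sup>T W + G\<^sup>T Y\<close>.
  If \<open>W\<close> were singular, its \<open>G\<close>-stable kernel would contain an eigenvector \<open>x\<close> of \<open>G\<close>, and then
  \<open>Z x = \<mu> G\<^sup>T Z x\<close> with \<open>Z x \<noteq> 0\<close>, so \<open>\<mu>\<close> and \<open>1/\<mu>\<close> would both be eigenvalues of \<open>G\<close>
  (\<open>deflating_block_nonsingular\<close>).

  So \<open>V = Y W\<^sup>-\<^sup>1\<close> and \<open>V' = Z W\<^sup>-\<^sup>1\<close> exist and satisfy \<open>V = K + V' G\<close>, \<open>V' = K\<^sup>T + G\<^sup>T V\<close>.
  Transposing, \<open>(V'\<^sup>T, V\<^sup>T)\<close> satisfies the same two equations.  They have at most one solution,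
  because the difference of two solutions satisfies \<open>E = G\<^sup>T E G\<close>, a Sylvester equation excluded
  above; hence \<open>V' = V\<^sup>T\<close> and \<open>V = K + V\<^sup>T G\<close>.  For nonsingular \<open>A\<close> and \<open>V = X A\<^sup>T\<close> this is the
  equation \<open>X = A X\<^sup>T B + C\<close> multiplied by \<open>A\<^sup>T\<close>; the same uniqueness statement makes its solution
  unique over the complex numbers, and a unique solution equals its complex conjugate, so it is real.
\<close>

section \<open>Nonsingular matrices\<close>

lemma mat_inv_inverts:
  fixes A :: "'a :: field mat"
  assumes A: "A \<in> carrier_mat n n" and d: "det A \<noteq> 0"
  shows "mat_inv A \<in> carrier_mat n n" "A * mat_inv A = 1\<^sub>m n" "mat_inv A * A = 1\<^sub>m n"
proof -
  obtain B where "mat_inverse A = Some B"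
    using mat_inverse(1)[OF A, where b = "()"] det_non_zero_imp_unit[OF A d, where b = "()"]
    by (cases "mat_inverse A") auto
  with mat_inverse(2)[OF A this]
  show "mat_inv A \<in> carrier_mat n n" "A * mat_inv A = 1\<^sub>m n" "mat_inv A * A = 1\<^sub>m n"
    by (simp_all add: mat_inv_def)
qed

lemma det_nonzero_if_left_inverse:
  fixes A B :: "'a :: field mat"
  assumes "A \<in> carrier_mat n n" "B \<in> carrier_mat n n" "B * A = 1\<^sub>m n"
  shows "det A \<noteq> 0"
  using det_mult[of B n A] assms by auto

lemma invertible_mat_iff_det_nonzero:
  fixes A :: "'a :: field mat"
  assumes A: "A \<in> carrier_mat n n"
  shows "invertible_mat A \<longleftrightarrow> det A \<noteq> 0"
proof
  assume "invertible_mat A"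
  then obtain B where AB: "A * B = 1\<^sub>m n" and BA: "B * A = 1\<^sub>m (dim_row B)"
    using A by (auto simp: invertible_mat_def inverts_mat_def)
  have "dim_col B = n"
    using arg_cong[OF AB, of dim_col] by simp
  moreover have "dim_row B = n"
    using arg_cong[OF BA, of dim_col] A by simp
  ultimately show "det A \<noteq> 0"
    using det_nonzero_if_left_inverse[OF A _ ] BA by (metis carrier_matI)
next
  assume "det A \<noteq> 0"
  from mat_inv_inverts[OF A this] show "invertible_mat A"
    using A unfolding invertible_mat_def inverts_mat_def by auto
qed

lemma mult_left_cancel_zero:
  fixes A :: "'a :: field mat"
  assumes A: "A \<in> carrier_mat n n" and d: "det A \<noteq> 0"
    and M: "M \<in> carrier_mat n m" and z: "A * M = 0\<^sub>m n m"
  shows "M = 0\<^sub>m n m"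
proof -
  note i = mat_inv_inverts[OF A d]
  have "M = mat_inv A * A * M" using i M by simp
  also have "\<dots> = mat_inv A * (A * M)" by (rule assoc_mult_mat[OF i(1) A M])
  finally show ?thesis using i(1) z by simp
qed

lemma mult_right_cancel:
  fixes A :: "'a :: field mat"
  assumes A: "A \<in> carrier_mat n n" and d: "det A \<noteq> 0"
    and M: "M \<in> carrier_mat m n" and N: "N \<in> carrier_mat m n" and eq: "M * A = N * A"
  shows "M = N"
proof -
  note i = mat_inv_inverts[OF A d]
  have "M = M * A * mat_inv A" using i A M by simp
  also have "\<dots> = N" unfolding eq using i A N by simp
  finally show ?thesis .
qed

section \<open>Spectra and invariant sets of matrices\<close>

lemma spectrum_iff_det:
  fixes A :: "'a :: field mat"
  assumes A: "A \<in> carrier_mat n n"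
  shows "\<mu> \<in> spectrum A \<longleftrightarrow> det (A - \<mu> \<cdot>\<^sub>m 1\<^sub>m n) = 0"
proof -
  have "char_matrix A \<mu> = A - \<mu> \<cdot>\<^sub>m 1\<^sub>m n"
    using A by (intro eq_matI) (auto simp: char_matrix_def)
  then show ?thesis by (simp add: spectrum_def eigenvalue_det[OF A])
qed

lemma spectrum_transpose:
  fixes A :: "'a :: field mat"
  assumes A: "A \<in> carrier_mat n n"
  shows "spectrum A\<^sup>T = spectrum A"
  using A eigenvalue_root_char_poly[OF A] eigenvalue_root_char_poly[of "A\<^sup>T" n]
  by (auto simp: spectrum_def)

lemma eigenvalue_of_matrix_eigenvectors:
  fixes A :: "'a :: field mat"
  assumes A: "A \<in> carrier_mat n n" and M: "M \<in> carrier_mat n m"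
    and eq: "A * M = \<mu> \<cdot>\<^sub>m M" and nz: "M \<noteq> 0\<^sub>m n m"
  shows "\<mu> \<in> spectrum A"
proof (rule ccontr)
  assume "\<mu> \<notin> spectrum A"
  then have "det (A - \<mu> \<cdot>\<^sub>m 1\<^sub>m n) \<noteq> 0" by (simp add: spectrum_iff_det[OF A])
  moreover have "(A - \<mu> \<cdot>\<^sub>m 1\<^sub>m n) * M = 0\<^sub>m n m"
  proof -
    have "(A - \<mu> \<cdot>\<^sub>m 1\<^sub>m n) * M = A * M - (\<mu> \<cdot>\<^sub>m 1\<^sub>m n) * M"
      using A M by (intro minus_mult_distrib_mat) auto
    also have "(\<mu> \<cdot>\<^sub>m 1\<^sub>m n) * M = \<mu> \<cdot>\<^sub>m M"
      using M mult_smult_assoc_mat[of "1\<^sub>m n" n n M m \<mu>] by simp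
    finally show ?thesis using M eq by simp
  qed
  ultimately show False
    using mult_left_cancel_zero[of "A - \<mu> \<cdot>\<^sub>m 1\<^sub>m n" n M m] A M nz
    by (simp add: minus_carrier_mat)
qed

text \<open>
  Triangularise \<open>G = P B Q\<close> and look at the last nonzero row of \<open>Q M\<close>.  If that is row \<open>i\<close>, then
  subtracting \<open>B\<^sub>i\<^sub>i M\<close> from \<open>G M\<close> clears row \<open>i\<close> and leaves the rows below it zero.  So if \<open>M\<close>
  is chosen among the nonzero members of \<open>S\<close> with \<open>i\<close> minimal, the difference is zero.  A linear
  subspace invariant under \<open>G\<close> is stable under all the maps \<open>M \<mapsto> G M - \<mu> M\<close>.
\<close>

lemma invariant_set_contains_eigenmatrix:
  fixes G :: "complex mat"
  assumes G: "G \<in> carrier_mat n n"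
    and S: "S \<subseteq> carrier_mat n m"
    and inv: "\<And>M \<mu>. M \<in> S \<Longrightarrow> G * M - \<mu> \<cdot>\<^sub>m M \<in> S"
    and M0: "M0 \<in> S" "M0 \<noteq> 0\<^sub>m n m"
  obtains M \<mu> where "M \<in> S" "M \<noteq> 0\<^sub>m n m" "G * M = \<mu> \<cdot>\<^sub>m M" "\<mu> \<in> spectrum G"
proof -
  obtain es where "char_poly G = (\<Prod>a\<leftarrow>es. [:- a, 1:])"
    using char_poly_factorized[OF G] by auto
  from schur_decomposition_exists[OF G this] obtain B P Q
    where B: "B \<in> carrier_mat n n" and ut: "upper_triangular B" and w: "similar_mat_wit G B P Q"
    by (auto simp: similar_mat_def)
  note W = similar_mat_witD2[OF G w]
  note P = W(6) and Q = W(7)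
  define zero_from where "zero_from M i \<longleftrightarrow> (\<forall>r<n. i \<le> r \<longrightarrow> (\<forall>c<m. (Q * M) $$ (r, c) = 0))" for M i
  \<comment> \<open>The index counts the leading rows that may be nonzero, so the last of them is \<open>i - 1\<close>.\<close>
  define attained where "attained i \<longleftrightarrow> (\<exists>M\<in>S. M \<noteq> 0\<^sub>m n m \<and> zero_from M i)" for i
  have "attained n" using M0 by (auto simp: attained_def zero_from_def)
  then obtain i where i: "attained i" and least: "\<And>j. j < i \<Longrightarrow> \<not> attained j"
    by (metis LeastI not_less_Least)
  obtain M where M: "M \<in> S" "M \<noteq> 0\<^sub>m n m" "zero_from M i"
    using i by (auto simp: attained_def)
  have Mc: "M \<in> carrier_mat n m" using M S by auto
  have QM: "Q * M \<in> carrier_mat n m" using Q Mc by simp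
  have i0: "0 < i"
  proof (rule ccontr)
    assume "\<not> 0 < i"
    then have "Q * M = 0\<^sub>m n m"
      using M(3) QM by (intro eq_matI) (auto simp: zero_from_def)
    then have "P * (Q * M) = 0\<^sub>m n m" using P by simp
    moreover have "P * (Q * M) = M"
      using assoc_mult_mat[OF P Q Mc] W(1) Mc by simp
    ultimately show False using M(2) by simp
  qed
  define d where "d = B $$ (i - 1, i - 1)"
  define M' where "M' = G * M - d \<cdot>\<^sub>m M"
  have M': "M' \<in> S" unfolding M'_def by (rule inv[OF M(1)])
  have QM': "Q * M' = B * (Q * M) - d \<cdot>\<^sub>m (Q * M)"
  proof -
    have "Q * M' = Q * (G * M) - Q * (d \<cdot>\<^sub>m M)"
      unfolding M'_def using Q G Mc by (intro mult_minus_distrib_mat) auto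
    also have "Q * (d \<cdot>\<^sub>m M) = d \<cdot>\<^sub>m (Q * M)" using Q Mc by (rule mult_smult_distrib)
    also have "Q * (G * M) = Q * G * M" using Q G Mc by simp
    also have "Q * G = (Q * P) * (B * Q)" unfolding W(3) using P Q B
      by (simp add: assoc_mult_mat[of _ n n _ n _ n])
    also have "\<dots> = B * Q" using W(2) B Q by simp
    also have "B * Q * M = B * (Q * M)" using B Q Mc by simp
    finally show ?thesis .
  qed
  have "zero_from M' (i - 1)"
    unfolding zero_from_def
  proof (intro allI impI)
    fix r c assume r: "r < n" "i - 1 \<le> r" and c: "c < m"
    have "(B * N) $$ (r, c) = (\<Sum>j<n. B $$ (r, j) * N $$ (j, c))"
      if "N \<in> carrier_mat n m" for N
      using that B r c by (simp add: scalar_prod_def atLeast0LessThan)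
    from this[OF QM]
    have "(B * (Q * M)) $$ (r, c) = (\<Sum>j<n. B $$ (r, j) * (Q * M) $$ (j, c))" .
    also have "\<dots> = (\<Sum>j\<in>{r}. B $$ (r, j) * (Q * M) $$ (j, c))"
    proof (rule sum.mono_neutral_right)
      show "\<forall>j\<in>{..<n} - {r}. B $$ (r, j) * (Q * M) $$ (j, c) = 0"
      proof
        fix j assume j: "j \<in> {..<n} - {r}"
        show "B $$ (r, j) * (Q * M) $$ (j, c) = 0"
        proof (cases "j < r")
          case True
          then show ?thesis using upper_triangularD[OF ut] B r by auto
        next
          case False
          then have "i \<le> j" using j r i0 by auto
          then show ?thesis using M(3) j c by (auto simp: zero_from_def)
        qed
      qed
    qed (use r in auto)
    finally have "(B * (Q * M)) $$ (r, c) = B $$ (r, r) * (Q * M) $$ (r, c)" by simp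
    moreover have "(Q * M) $$ (r, c) = 0 \<or> r = i - 1"
      using M(3) r c by (auto simp: zero_from_def)
    ultimately have "(B * (Q * M)) $$ (r, c) = d * (Q * M) $$ (r, c)"
      by (auto simp: d_def)
    then show "(Q * M') $$ (r, c) = 0"
      unfolding QM' using r c QM Q Mc by simp
  qed
  then have "M' = 0\<^sub>m n m"
    using least[of "i - 1"] i0 M' by (auto simp: attained_def)
  have eq: "G * M = d \<cdot>\<^sub>m M"
  proof (rule eq_matI)
    fix r c assume rc: "r < dim_row (d \<cdot>\<^sub>m M)" "c < dim_col (d \<cdot>\<^sub>m M)"
    have "M' $$ (r, c) = 0" using \<open>M' = 0\<^sub>m n m\<close> rc Mc by simp
    then show "(G * M) $$ (r, c) = (d \<cdot>\<^sub>m M) $$ (r, c)"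
      unfolding M'_def using rc Mc G by simp
  qed (use G Mc in auto)
  show thesis
    by (rule that[OF M(1,2) eq eigenvalue_of_matrix_eigenvectors[OF G Mc eq M(2)]])
qed

text \<open>
  The solution set of \<open>G M T2 = M T1\<close> is stable under left multiplication by \<open>G\<close>, so a nonzero
  solution could be chosen as an eigenmatrix of \<open>G\<close>, which the pencil \<open>T1 - \<mu> T2\<close> would annihilate.
\<close>

lemma generalized_Sylvester_zero:
  fixes G X T1 T2 :: "complex mat"
  assumes G: "G \<in> carrier_mat n n" and X: "X \<in> carrier_mat n k"
    and T1: "T1 \<in> carrier_mat k k" and T2: "T2 \<in> carrier_mat k k"
    and eq: "G * X * T2 = X * T1"
    and reg: "\<And>\<mu>. \<mu> \<in> spectrum G \<Longrightarrow> det (T1 - \<mu> \<cdot>\<^sub>m T2) \<noteq> 0"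
  shows "X = 0\<^sub>m n k"
proof (rule ccontr)
  assume nz: "X \<noteq> 0\<^sub>m n k"
  define S where "S = {M \<in> carrier_mat n k. G * M * T2 = M * T1}"
  have "G * M - \<mu> \<cdot>\<^sub>m M \<in> S" if "M \<in> S" for M \<mu>
  proof -
    have M: "M \<in> carrier_mat n k" and e: "G * M * T2 = M * T1" using that by (auto simp: S_def)
    have "G * (G * M - \<mu> \<cdot>\<^sub>m M) * T2 = G * (G * M * T2) - \<mu> \<cdot>\<^sub>m (G * M * T2)"
      using G M T2 by (simp add: assoc_mult_mat[of G n n _ k _ k] mult_minus_distrib_mat[of G n n _ k] minus_mult_distrib_mat[of _ n k]
          mult_smult_distrib[of G n n] mult_smult_assoc_mat[of _ n k])
    also have "\<dots> = (G * M - \<mu> \<cdot>\<^sub>m M) * T1"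
      unfolding e using G M T1
      by (simp add: minus_mult_distrib_mat[of _ n k] mult_smult_assoc_mat[of _ n k])
    finally show ?thesis
      unfolding S_def using M by (auto intro!: minus_carrier_mat)
  qed
  note inv = this
  have Sc: "S \<subseteq> carrier_mat n k" and XS: "X \<in> S" using X eq by (auto simp: S_def)
  obtain M \<mu> where MS: "M \<in> S" and Mnz: "M \<noteq> 0\<^sub>m n k" and ev: "G * M = \<mu> \<cdot>\<^sub>m M"
    and sp: "\<mu> \<in> spectrum G"
    using invariant_set_contains_eigenmatrix[OF G Sc inv XS nz] by blast
  from MS have M: "M \<in> carrier_mat n k" and e: "G * M * T2 = M * T1" by (auto simp: S_def)
  have "M * T1 = \<mu> \<cdot>\<^sub>m (M * T2)"
    using e M T2 by (simp add: ev mult_smult_assoc_mat[of _ n k])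
  then have "M * (T1 - \<mu> \<cdot>\<^sub>m T2) = 0\<^sub>m n k"
    using M T1 T2 by (simp add: mult_minus_distrib_mat[of _ n k] mult_smult_distrib[of _ n k])
  then have "M = 0\<^sub>m n k"
    using M T1 T2 by (intro mult_right_cancel[OF _ reg[OF sp] M]) (auto simp: minus_carrier_mat)
  then show False using Mnz by simp
qed

section \<open>Stein equations with a reciprocal free coefficient\<close>

lemma inverse_of_reciprocal_pencil_root:
  fixes G :: "'a :: field mat"
  assumes G: "G \<in> carrier_mat n n" and d: "det (1\<^sub>m n - \<mu> \<cdot>\<^sub>m G) = 0"
  shows "\<mu> \<noteq> 0" "inverse \<mu> \<in> spectrum G"
proof -
  show nz: "\<mu> \<noteq> 0"
  proof
    assume "\<mu> = 0"
    then have "1\<^sub>m n - \<mu> \<cdot>\<^sub>m G = 1\<^sub>m n" using G by (intro eq_matI) auto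
    then show False using d by simp
  qed
  have "G - inverse \<mu> \<cdot>\<^sub>m 1\<^sub>m n = (- inverse \<mu>) \<cdot>\<^sub>m (1\<^sub>m n - \<mu> \<cdot>\<^sub>m G)"
    using G nz by (intro eq_matI) (auto simp: field_simps)
  then have "det (G - inverse \<mu> \<cdot>\<^sub>m 1\<^sub>m n) = 0"
    using d by (simp add: det_smult)
  then show "inverse \<mu> \<in> spectrum G" by (simp add: spectrum_iff_det[OF G])
qed

lemma reciprocal_free_det_nonzero:
  fixes G :: "complex mat"
  assumes G: "G \<in> carrier_mat n n" and free: "T_reciprocal_free (spectrum G)"
    and sp: "\<mu> \<in> spectrum G"
  shows "det (1\<^sub>m n - \<mu> \<cdot>\<^sub>m G) \<noteq> 0"
  using inverse_of_reciprocal_pencil_root[OF G, of \<mu>] free sp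
  by (force simp: T_reciprocal_free_def)

lemma det_reciprocal_pencil_transpose:
  fixes G :: "'a :: field mat"
  assumes G: "G \<in> carrier_mat n n"
  shows "det (1\<^sub>m n - \<mu> \<cdot>\<^sub>m G\<^sup>T) = det (1\<^sub>m n - \<mu> \<cdot>\<^sub>m G)"
proof -
  have "1\<^sub>m n - \<mu> \<cdot>\<^sub>m G\<^sup>T = (1\<^sub>m n - \<mu> \<cdot>\<^sub>m G)\<^sup>T"
    using G by (intro eq_matI) auto
  moreover have "1\<^sub>m n - \<mu> \<cdot>\<^sub>m G \<in> carrier_mat n n"
    using G by (intro minus_carrier_mat smult_carrier_mat)
  ultimately show ?thesis using det_transpose by simp
qed

lemma Stein_homogeneous_zero:
  fixes G E :: "complex mat"
  assumes G: "G \<in> carrier_mat n n" and free: "T_reciprocal_free (spectrum G)"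
    and E: "E \<in> carrier_mat n n" and eq: "E = G\<^sup>T * E * G"
  shows "E = 0\<^sub>m n n"
proof (rule generalized_Sylvester_zero[of "G\<^sup>T" n E n "1\<^sub>m n" G])
  show "det (1\<^sub>m n - \<mu> \<cdot>\<^sub>m G) \<noteq> 0" if "\<mu> \<in> spectrum G\<^sup>T" for \<mu>
    using that reciprocal_free_det_nonzero[OF G free] spectrum_transpose[OF G] by simp
qed (use G E eq in auto)

lemma transpose_affine:
  fixes K W G :: "'a :: comm_semiring_0 mat"
  assumes K: "K \<in> carrier_mat n n" and W: "W \<in> carrier_mat n n" and G: "G \<in> carrier_mat n n"
  shows "(K + W * G)\<^sup>T = K\<^sup>T + G\<^sup>T * W\<^sup>T"
proof -
  have "(K + W * G)\<^sup>T = K\<^sup>T + (W * G)\<^sup>T"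
    using K W G by (intro transpose_add) auto
  then show ?thesis unfolding transpose_mult[OF W G] .
qed

text \<open>
  A \<open>\<top>\<close>-equation \<open>V = K + V\<^sup>T G\<close> is the case \<open>W = V\<^sup>T\<close> of this linear system.  In the system the
  two unknowns are independent, which is what allows both to prove \<open>W = Z\<^sup>T\<close> for a given solution
  and to derive uniqueness for the \<open>\<top>\<close>-equation.
\<close>

lemma coupled_Stein_unique:
  fixes G K Z W Z' W' :: "complex mat"
  assumes G: "G \<in> carrier_mat n n" and free: "T_reciprocal_free (spectrum G)"
    and K: "K \<in> carrier_mat n n"
    and Z: "Z \<in> carrier_mat n n" and W: "W \<in> carrier_mat n n"
    and Z': "Z' \<in> carrier_mat n n" and W': "W' \<in> carrier_mat n n"
    and eqs: "Z = K + W * G" "W = K\<^sup>T + G\<^sup>T * Z" "Z' = K + W' * G" "W' = K\<^sup>T + G\<^sup>T * Z'"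
  shows "Z = Z'"
proof -
  have GT: "G\<^sup>T \<in> carrier_mat n n" and KT: "K\<^sup>T \<in> carrier_mat n n" using G K by auto
  have 1: "Z - Z' = (W - W') * G"
  proof -
    have "Z - Z' = (K + W * G) - (K + W' * G)" using eqs(1,3) by simp
    also have "\<dots> = W * G - W' * G"
      using K W W' G by (intro eq_matI) auto
    finally show ?thesis using W W' G by (simp add: minus_mult_distrib_mat[of _ n n])
  qed
  have 2: "W - W' = G\<^sup>T * (Z - Z')"
  proof -
    have "W - W' = (K\<^sup>T + G\<^sup>T * Z) - (K\<^sup>T + G\<^sup>T * Z')" using eqs(2,4) by simp
    also have "\<dots> = G\<^sup>T * Z - G\<^sup>T * Z'"
      using KT Z Z' GT by (intro eq_matI) auto
    finally show ?thesis using Z Z' GT by (simp add: mult_minus_distrib_mat[of _ n n])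
  qed
  have zero: "Z - Z' = 0\<^sub>m n n"
    using 1 2 Z Z' by (intro Stein_homogeneous_zero[OF G free]) (auto intro: minus_carrier_mat)
  show ?thesis
  proof (rule eq_matI)
    fix i j assume ij: "i < dim_row Z'" "j < dim_col Z'"
    have "(Z - Z') $$ (i, j) = 0" using zero ij Z' by simp
    then show "Z $$ (i, j) = Z' $$ (i, j)" using ij by simp
  qed (use Z Z' in auto)
qed

section \<open>Stacked matrices of full column rank\<close>

text \<open>
  Rank is defined by the span of the set of columns, so repeated columns have to be excluded first:
  they would make this set, and with it the rank, smaller than the number of columns.
\<close>

lemma full_column_rank_kernel:
  fixes A :: "'a :: field mat"
  assumes A: "A \<in> carrier_mat m k" and rk: "vec_space.rank m A = k"
    and v: "v \<in> carrier_vec k" and z: "A *\<^sub>v v = 0\<^sub>v m"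
  shows "v = 0\<^sub>v k"
proof (rule ccontr)
  assume nz: "v \<noteq> 0\<^sub>v k"
  interpret vec_space "TYPE('a)" m .
  obtain S where S: "maximal S (\<lambda>T. T \<subseteq> set (cols A) \<and> lin_indpt T)"
    using maximal_exists_superset[of "set (cols A)" "\<lambda>T. T \<subseteq> set (cols A) \<and> lin_indpt T" "{}"]
    by (auto simp: lin_dep_def)
  have "k = card S" using rank_card_indpt[OF A S] rk by simp
  also have "\<dots> \<le> card (set (cols A))"
    using S by (auto simp: maximal_def intro: card_mono)
  finally have "distinct (cols A)"
    using A card_length[of "cols A"] by (intro card_distinct) auto
  with lin_depI[OF A v nz z] full_rank_lin_indpt[OF A rk] show False by blast
qed

lemma full_column_rank_cancel:
  fixes A :: "'a :: field mat"
  assumes A: "A \<in> carrier_mat m k" and rk: "vec_space.rank m A = k"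
    and M: "M \<in> carrier_mat k l" and z: "A * M = 0\<^sub>m m l"
  shows "M = 0\<^sub>m k l"
proof (rule eq_matI)
  fix i j assume ij: "i < dim_row (0\<^sub>m k l)" "j < dim_col (0\<^sub>m k l)"
  have "A *\<^sub>v col M j = col (A * M) j" using A M ij by (intro eq_vecI) auto
  also have "\<dots> = 0\<^sub>v m" using z ij by simp
  finally have "col M j = 0\<^sub>v k"
    using M by (intro full_column_rank_kernel[OF A rk]) auto
  then have "col M j $ i = 0" using ij by simp
  then show "M $$ (i, j) = 0\<^sub>m k l $$ (i, j)" using ij M by simp
qed (use M in auto)


lemma four_block_mat_mult_append_rows:
  fixes A :: "'a :: semiring_0 mat"
  assumes "A \<in> carrier_mat n1 m1" "B \<in> carrier_mat n1 m2" "C \<in> carrier_mat n2 m1"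
    "D \<in> carrier_mat n2 m2" "U \<in> carrier_mat m1 k" "V \<in> carrier_mat m2 k"
  shows "four_block_mat A B C D * (U @\<^sub>r V) = (A * U + B * V) @\<^sub>r (C * U + D * V)"
proof -
  have "four_block_mat A B C D * (U @\<^sub>r V) =
      four_block_mat (A * U + B * V) (A * 0\<^sub>m m1 0 + B * 0\<^sub>m m2 0)
        (C * U + D * V) (C * 0\<^sub>m m1 0 + D * 0\<^sub>m m2 0)"
    unfolding append_rows_def using assms
    by (subst mult_four_block_mat[of A n1 m1 B m2 C n2 D U k _ 0]) auto
  also have "\<dots> = (A * U + B * V) @\<^sub>r (C * U + D * V)"
    unfolding append_rows_def using assms by (intro cong_four_block_mat) auto
  finally show ?thesis .
qed

lemma append_rows_mult:
  fixes U :: "'a :: semiring_0 mat"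
  assumes "U \<in> carrier_mat n k" "V \<in> carrier_mat m k" "T \<in> carrier_mat k l"
  shows "(U @\<^sub>r V) * T = (U * T) @\<^sub>r (V * T)"
proof (rule eq_matI)
  have c: "U @\<^sub>r V \<in> carrier_mat (n + m) k" "(U * T) @\<^sub>r (V * T) \<in> carrier_mat (n + m) l"
    using assms by auto
  fix i j assume "i < dim_row ((U * T) @\<^sub>r (V * T))" "j < dim_col ((U * T) @\<^sub>r (V * T))"
  then have ij: "i < n + m" "j < l" using c by auto
  have "row (U @\<^sub>r V) i = (if i < n then row U i else row V (i - n))"
    using ij assms by (intro eq_vecI) (auto simp: append_rows_def)
  then show "((U @\<^sub>r V) * T) $$ (i, j) = ((U * T) @\<^sub>r (V * T)) $$ (i, j)"
    using ij assms c by (auto simp: append_rows_def)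
qed (use assms in \<open>auto simp: append_rows_def\<close>)

lemma append_rows_eqD:
  assumes "U @\<^sub>r V = U' @\<^sub>r V'"
    and "U \<in> carrier_mat n k" "U' \<in> carrier_mat n k" "V \<in> carrier_mat m k" "V' \<in> carrier_mat m k"
  shows "U = U'" "V = V'"
proof -
  have e: "(U @\<^sub>r V) $$ (i, j) = (U' @\<^sub>r V') $$ (i, j)" for i j using assms(1) by simp
  show "U = U'"
  proof (rule eq_matI)
    fix i j assume "i < dim_row U'" "j < dim_col U'"
    then show "U $$ (i, j) = U' $$ (i, j)"
      using e[of i j] assms(2-) by (simp add: append_rows_def)
  qed (use assms in auto)
  show "V = V'"
  proof (rule eq_matI)
    fix i j assume "i < dim_row V'" "j < dim_col V'"
    then show "V $$ (i, j) = V' $$ (i, j)"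
      using e[of "n + i" j] assms(2-) by (simp add: append_rows_def)
  qed (use assms in auto)
qed

lemma append_rows_zero: "0\<^sub>m n k @\<^sub>r 0\<^sub>m m k = (0\<^sub>m (n + m) k :: 'a :: zero mat)"
  by (rule eq_matI) (auto simp: append_rows_def)

section \<open>Deflating bases of the pencil in normalised form\<close>

text \<open>
  The kernel of \<open>W\<close> is stable under \<open>G\<close>, so if it is nonzero it contains an eigenvector \<open>M\<close> of \<open>G\<close>.
  On \<open>M\<close> the two equations collapse to \<open>Y M = \<mu> Z M\<close> and \<open>Z M = G\<^sup>T Y M\<close>, and \<open>I - \<mu> G\<^sup>T\<close> is
  nonsingular by reciprocal freeness, so \<open>Z M = 0\<close> as well.  Vectors are \<open>n \<times> 1\<close> matrices here.
\<close>

lemma deflating_block_nonsingular: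
  fixes G K W Y Z :: "complex mat"
  assumes G: "G \<in> carrier_mat n n" and K: "K \<in> carrier_mat n n"
    and W: "W \<in> carrier_mat n n" and Y: "Y \<in> carrier_mat n n" and Z: "Z \<in> carrier_mat n n"
    and free: "T_reciprocal_free (spectrum G)"
    and comm: "G * W = W * G"
    and Yeq: "Y = K * W + Z * G" and Zeq: "Z = K\<^sup>T * W + G\<^sup>T * Y"
    and inj: "\<And>M. M \<in> carrier_mat n 1 \<Longrightarrow> W * M = 0\<^sub>m n 1 \<Longrightarrow> Z * M = 0\<^sub>m n 1 \<Longrightarrow> M = 0\<^sub>m n 1"
  shows "det W \<noteq> 0"
proof
  assume "det W = 0"
  then obtain v where v: "v \<in> carrier_vec n" "v \<noteq> 0\<^sub>v n" "W *\<^sub>v v = 0\<^sub>v n"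
    using det_0_iff_vec_prod_zero_field[OF W] by auto
  define S where "S = {M \<in> carrier_mat n 1. W * M = 0\<^sub>m n 1}"
  define M0 where "M0 = mat_of_cols n [v]"
  have M0c: "M0 \<in> carrier_mat n 1"
    using mat_of_cols_carrier(1)[of n "[v]"] by (simp add: M0_def)
  have col0: "col M0 0 = v" using v by (simp add: M0_def)
  have "M0 \<noteq> 0\<^sub>m n 1" using col0 v by auto
  moreover have "W * M0 = 0\<^sub>m n 1"
  proof (rule eq_matI)
    fix i j assume ij: "i < dim_row (0\<^sub>m n 1 :: complex mat)" "j < dim_col (0\<^sub>m n 1 :: complex mat)"
    then have "(W * M0) $$ (i, j) = (W *\<^sub>v v) $ i" using W M0c col0 by simp
    then show "(W * M0) $$ (i, j) = 0\<^sub>m n 1 $$ (i, j)" using v ij by simp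
  qed (use W M0c in auto)
  ultimately have M0: "M0 \<in> S" "M0 \<noteq> 0\<^sub>m n 1" using M0c by (auto simp: S_def)
  have inv: "G * M - \<mu> \<cdot>\<^sub>m M \<in> S" if "M \<in> S" for M \<mu>
  proof -
    have M: "M \<in> carrier_mat n 1" and WM: "W * M = 0\<^sub>m n 1" using that by (auto simp: S_def)
    have "W * (G * M - \<mu> \<cdot>\<^sub>m M) = W * (G * M) - \<mu> \<cdot>\<^sub>m (W * M)"
      using W G M by (simp add: mult_minus_distrib_mat[of W n n _ 1] mult_smult_distrib[of W n n])
    also have "W * (G * M) = G * (W * M)"
      using assoc_mult_mat[OF W G M] assoc_mult_mat[OF G W M] comm by simp
    finally have "W * (G * M - \<mu> \<cdot>\<^sub>m M) = 0\<^sub>m n 1"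
      using G by (simp add: WM)
    then show ?thesis unfolding S_def using M by (auto intro!: minus_carrier_mat)
  qed
  have Sc: "S \<subseteq> carrier_mat n 1" by (auto simp: S_def)
  obtain M \<mu> where MS: "M \<in> S" and Mnz: "M \<noteq> 0\<^sub>m n 1" and ev: "G * M = \<mu> \<cdot>\<^sub>m M"
    and sp: "\<mu> \<in> spectrum G"
    using invariant_set_contains_eigenmatrix[OF G Sc inv M0] by blast
  have M: "M \<in> carrier_mat n 1" and WM: "W * M = 0\<^sub>m n 1" using MS by (auto simp: S_def)
  have ZM: "Z * M \<in> carrier_mat n 1" and YM: "Y * M \<in> carrier_mat n 1" using Z Y M by auto
  have KWM: "L * W * M = 0\<^sub>m n 1" if "L \<in> carrier_mat n n" for L
    using that W M WM by simp
  have YMeq: "Y * M = \<mu> \<cdot>\<^sub>m (Z * M)"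
  proof -
    have "Y * M = K * W * M + Z * G * M"
      unfolding Yeq using K W Z G M by (simp add: add_mult_distrib_mat[of _ n n _ _ 1] del: assoc_mult_mat)
    also have "\<dots> = Z * (G * M)" unfolding KWM[OF K] using Z G M by simp
    also have "\<dots> = \<mu> \<cdot>\<^sub>m (Z * M)" unfolding ev using Z M by (rule mult_smult_distrib)
    finally show ?thesis .
  qed
  have ZMeq: "Z * M = \<mu> \<cdot>\<^sub>m (G\<^sup>T * (Z * M))"
  proof -
    have GT: "G\<^sup>T \<in> carrier_mat n n" and KT: "K\<^sup>T \<in> carrier_mat n n" using G K by auto
    have "Z * M = (K\<^sup>T * W + G\<^sup>T * Y) * M" using Zeq by (rule arg_cong)
    also have "\<dots> = K\<^sup>T * W * M + G\<^sup>T * Y * M"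
      using KT W GT Y M by (simp add: add_mult_distrib_mat[of _ n n _ _ 1] del: assoc_mult_mat)
    also have "\<dots> = G\<^sup>T * (Y * M)" unfolding KWM[OF KT] using GT Y M by simp
    also have "\<dots> = \<mu> \<cdot>\<^sub>m (G\<^sup>T * (Z * M))" unfolding YMeq using GT ZM by (rule mult_smult_distrib)
    finally show ?thesis .
  qed
  have "(1\<^sub>m n - \<mu> \<cdot>\<^sub>m G\<^sup>T) * (Z * M) = Z * M - \<mu> \<cdot>\<^sub>m (G\<^sup>T * (Z * M))"
    using G ZM left_mult_one_mat[OF ZM]
    by (simp add: minus_mult_distrib_mat[of _ n n _ _ 1] mult_smult_assoc_mat[of _ n n _ 1]
        del: assoc_mult_mat)
  also have "\<dots> = 0\<^sub>m n 1"
    unfolding ZMeq[symmetric] using ZM by simp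
  finally have zero: "(1\<^sub>m n - \<mu> \<cdot>\<^sub>m G\<^sup>T) * (Z * M) = 0\<^sub>m n 1" .
  have det: "det (1\<^sub>m n - \<mu> \<cdot>\<^sub>m G\<^sup>T) \<noteq> 0"
    unfolding det_reciprocal_pencil_transpose[OF G] by (rule reciprocal_free_det_nonzero[OF G free sp])
  have "1\<^sub>m n - \<mu> \<cdot>\<^sub>m G\<^sup>T \<in> carrier_mat n n"
    using G by (intro minus_carrier_mat smult_carrier_mat) simp
  from mult_left_cancel_zero[OF this det ZM zero] have "Z * M = 0\<^sub>m n 1" .
  with inj[OF M WM] Mnz show False by simp
qed

text \<open>
  Dividing by \<open>W\<close>, which commutes with \<open>G\<close>, gives a solution \<open>(Y W\<^sup>-\<^sup>1, Z W\<^sup>-\<^sup>1)\<close> of the coupled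
  system.  Swapping and transposing the components of a solution gives a solution again, so
  uniqueness forces \<open>Z W\<^sup>-\<^sup>1 = (Y W\<^sup>-\<^sup>1)\<^sup>T\<close>.
\<close>

lemma deflating_block_quotient:
  fixes G K W Y Z :: "complex mat"
  assumes G: "G \<in> carrier_mat n n" and K: "K \<in> carrier_mat n n"
    and W: "W \<in> carrier_mat n n" and Y: "Y \<in> carrier_mat n n" and Z: "Z \<in> carrier_mat n n"
    and free: "T_reciprocal_free (spectrum G)"
    and comm: "G * W = W * G"
    and Yeq: "Y = K * W + Z * G" and Zeq: "Z = K\<^sup>T * W + G\<^sup>T * Y"
    and d: "det W \<noteq> 0"
  obtains V where "V \<in> carrier_mat n n" "V * W = Y" "V\<^sup>T * W = Z" "V = K + V\<^sup>T * G"
proof -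
  note i = mat_inv_inverts[OF W d]
  define R where "R = mat_inv W"
  have R: "R \<in> carrier_mat n n" and WR: "W * R = 1\<^sub>m n" and RW: "R * W = 1\<^sub>m n"
    using i by (auto simp: R_def)
  note as = assoc_mult_mat[of _ n n _ n _ n]
  have GT: "G\<^sup>T \<in> carrier_mat n n" and KT: "K\<^sup>T \<in> carrier_mat n n" using G K by auto
  have GR: "G * R = R * G"
  proof (rule mult_right_cancel[OF W d])
    have "R * G * W = R * (W * G)" using R G W comm by (simp add: as)
    also have "\<dots> = R * W * G" using R G W by (simp add: as)
    also have "\<dots> = G * R * W" using R G W by (simp add: as RW)
    finally show "G * R * W = R * G * W" ..
  qed (use G R in auto)
  define V where "V = Y * R"
  define V' where "V' = Z * R"
  have V: "V \<in> carrier_mat n n" and V': "V' \<in> carrier_mat n n"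
    using Y Z R by (auto simp: V_def V'_def)
  have eq1: "V = K + V' * G"
  proof -
    have "V = (K * W + Z * G) * R" unfolding V_def using Yeq by (rule arg_cong)
    also have "\<dots> = K * W * R + Z * G * R"
      using K W Z G R by (simp add: add_mult_distrib_mat[of _ n n _ _ n] del: assoc_mult_mat)
    also have "K * W * R = K" using K W R by (simp add: as WR)
    also have "Z * G * R = V' * G" unfolding V'_def using Z G R by (simp add: as GR)
    finally show ?thesis .
  qed
  have eq2: "V' = K\<^sup>T + G\<^sup>T * V"
  proof -
    have "V' = (K\<^sup>T * W + G\<^sup>T * Y) * R" unfolding V'_def using Zeq by (rule arg_cong)
    also have "\<dots> = K\<^sup>T * W * R + G\<^sup>T * Y * R"
      using KT W GT Y R by (simp add: add_mult_distrib_mat[of _ n n _ _ n] del: assoc_mult_mat)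
    also have "K\<^sup>T * W * R = K\<^sup>T" using KT W R by (simp add: as WR)
    also have "G\<^sup>T * Y * R = G\<^sup>T * V" unfolding V_def using Y GT R by (simp add: as)
    finally show ?thesis .
  qed
  have VT: "V\<^sup>T \<in> carrier_mat n n" using V by simp
  have eq3: "V'\<^sup>T = K + V\<^sup>T * G"
    using eq2 transpose_affine[OF K VT G] by (metis transpose_transpose)
  have eq4: "V\<^sup>T = K\<^sup>T + G\<^sup>T * V'\<^sup>T"
    using eq1 transpose_affine[OF K V' G] by simp
  have "V = V'\<^sup>T"
    by (rule coupled_Stein_unique[OF G free K _ _ _ _ eq1 eq2 eq3 eq4]) (use V V' in auto)
  then have VV': "V\<^sup>T = V'" by simp
  show thesis
  proof (rule that[OF V])
    show "V * W = Y" unfolding V_def using Y R W by (simp add: as RW)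
    show "V\<^sup>T * W = Z" unfolding VV' unfolding V'_def using Z R W by (simp add: as RW)
    show "V = K + V\<^sup>T * G" unfolding VV' by (rule eq1)
  qed
qed

section \<open>Solutions of the \<open>\<top>\<close>-Stein equation\<close>

lemma T_Stein_solutionsI:
  "X \<in> carrier_mat n n \<Longrightarrow> X = A * X\<^sup>T * B + C \<Longrightarrow> X \<in> T_Stein_solutions n A B C"
  unfolding T_Stein_solutions_def by (rule CollectI) (rule conjI)

lemma T_Stein_solutionsD:
  assumes "X \<in> T_Stein_solutions n A B C"
  shows "X \<in> carrier_mat n n" "X = A * X\<^sup>T * B + C"
  using assms unfolding T_Stein_solutions_def by blast+

text \<open>
  Multiplying the equation by the nonsingular \<open>A\<^sup>T\<close> from the right makes it an equation for
  \<open>V = X A\<^sup>T\<close> alone, since \<open>A X\<^sup>T = V\<^sup>T\<close>.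
\<close>

lemma T_Stein_solutions_iff:
  fixes A :: "'a :: field mat"
  assumes A: "A \<in> carrier_mat n n" and d: "det A \<noteq> 0"
    and B: "B \<in> carrier_mat n n" and C: "C \<in> carrier_mat n n" and X: "X \<in> carrier_mat n n"
  shows "X \<in> T_Stein_solutions n A B C \<longleftrightarrow>
    X * A\<^sup>T = C * A\<^sup>T + (X * A\<^sup>T)\<^sup>T * (B * A\<^sup>T)"
proof -
  have AT: "A\<^sup>T \<in> carrier_mat n n" and XT: "X\<^sup>T \<in> carrier_mat n n" using A X by auto
  have dT: "det A\<^sup>T \<noteq> 0" using det_transpose[OF A] d by simp
  have "(X * A\<^sup>T)\<^sup>T = A * X\<^sup>T" using transpose_mult[OF X AT] by simp
  then have "C * A\<^sup>T + (X * A\<^sup>T)\<^sup>T * (B * A\<^sup>T) = C * A\<^sup>T + A * X\<^sup>T * B * A\<^sup>T"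
    using A AT XT B by (simp add: assoc_mult_mat[of _ n n _ n _ n])
  also have "\<dots> = A * X\<^sup>T * B * A\<^sup>T + C * A\<^sup>T"
    using A AT XT B C by (intro comm_add_mat) auto
  also have "\<dots> = (A * X\<^sup>T * B + C) * A\<^sup>T"
    using A AT XT B C by (intro add_mult_distrib_mat[symmetric]) auto
  finally have e: "C * A\<^sup>T + (X * A\<^sup>T)\<^sup>T * (B * A\<^sup>T) = (A * X\<^sup>T * B + C) * A\<^sup>T" .
  have "X = A * X\<^sup>T * B + C" if "X * A\<^sup>T = (A * X\<^sup>T * B + C) * A\<^sup>T"
    using mult_right_cancel[OF AT dT X _ that] A XT B C by auto
  then show ?thesis
    unfolding e T_Stein_solutions_def using X by auto
qed

lemma T_Stein_solution_unique:
  fixes A B C X X' :: "complex mat"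
  assumes A: "A \<in> carrier_mat n n" and d: "det A \<noteq> 0"
    and B: "B \<in> carrier_mat n n" and C: "C \<in> carrier_mat n n"
    and free: "T_reciprocal_free (spectrum (B * A\<^sup>T))"
    and X: "X \<in> T_Stein_solutions n A B C" and X': "X' \<in> T_Stein_solutions n A B C"
  shows "X = X'"
proof -
  let ?G = "B * A\<^sup>T" and ?K = "C * A\<^sup>T"
  have AT: "A\<^sup>T \<in> carrier_mat n n" and G: "?G \<in> carrier_mat n n" and K: "?K \<in> carrier_mat n n"
    using A B C by auto
  have dT: "det A\<^sup>T \<noteq> 0" using det_transpose[OF A] d by simp
  have Xc: "X \<in> carrier_mat n n" "X' \<in> carrier_mat n n"
    using T_Stein_solutionsD(1) X X' by blast+
  have coupled: "V\<^sup>T = ?K\<^sup>T + ?G\<^sup>T * V"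
    if V: "V \<in> carrier_mat n n" and e: "V = ?K + V\<^sup>T * ?G" for V
    using arg_cong[OF e, of transpose_mat] transpose_affine[OF K _ G, of "V\<^sup>T"] V by simp
  have e: "X * A\<^sup>T = ?K + (X * A\<^sup>T)\<^sup>T * ?G" "X' * A\<^sup>T = ?K + (X' * A\<^sup>T)\<^sup>T * ?G"
    using X X' T_Stein_solutions_iff[OF A d B C] Xc by blast+
  have c: "X * A\<^sup>T \<in> carrier_mat n n" "X' * A\<^sup>T \<in> carrier_mat n n" using Xc AT by auto
  have "X * A\<^sup>T = X' * A\<^sup>T"
    by (rule coupled_Stein_unique[OF G free K _ _ _ _ e(1) coupled[OF c(1) e(1)] e(2) coupled[OF c(2) e(2)]])
      (use c in auto)
  then show ?thesis by (rule mult_right_cancel[OF AT dT Xc])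
qed

lemma map_mat_T_Stein_solution:
  assumes h: "comm_ring_hom h"
    and A: "A \<in> carrier_mat n n" and B: "B \<in> carrier_mat n n" and C: "C \<in> carrier_mat n n"
    and X: "X \<in> T_Stein_solutions n A B C"
  shows "map_mat h X \<in> T_Stein_solutions n (map_mat h A) (map_mat h B) (map_mat h C)"
proof -
  interpret comm_ring_hom h by (rule h)
  have Xc: "X \<in> carrier_mat n n" and e: "X = A * X\<^sup>T * B + C"
    by (rule T_Stein_solutionsD[OF X])+
  have XT: "X\<^sup>T \<in> carrier_mat n n" using Xc by simp
  have "map_mat h X = map_mat h (A * X\<^sup>T * B + C)" using e by (rule arg_cong)
  also have "\<dots> = map_mat h (A * X\<^sup>T * B) + map_mat h C"
    using A XT B C by (intro eq_matI) (auto simp: hom_add)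
  also have "map_mat h (A * X\<^sup>T * B) = map_mat h A * (map_mat h X)\<^sup>T * map_mat h B"
    using A XT B by (simp add: mat_hom_mult[of _ n n _ n] map_mat_transpose)
  finally show ?thesis by (rule T_Stein_solutionsI[rotated]) (use Xc in simp)
qed

lemma map_mat_cnj_cmat: "map_mat cnj (cmat A) = cmat A"
  by (rule eq_matI) auto

text \<open>
  With real coefficients the entrywise conjugate of a solution is a solution, so a unique complex
  solution is fixed by conjugation.
\<close>

lemma real_T_Stein_solutions:
  fixes A B C :: "real mat"
  assumes A: "A \<in> carrier_mat n n" and B: "B \<in> carrier_mat n n" and C: "C \<in> carrier_mat n n"
    and sol: "T_Stein_solutions n (cmat A) (cmat B) (cmat C) = {X}"
  shows "cmat ` T_Stein_solutions n A B C = {X}"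
proof -
  have cA: "cmat A \<in> carrier_mat n n" and cB: "cmat B \<in> carrier_mat n n"
    and cC: "cmat C \<in> carrier_mat n n" using A B C by auto
  have X: "X \<in> T_Stein_solutions n (cmat A) (cmat B) (cmat C)" using sol by simp
  then have Xc: "X \<in> carrier_mat n n" by (rule T_Stein_solutionsD)
  have "comm_ring_hom cnj" by unfold_locales auto
  from map_mat_T_Stein_solution[OF this cA cB cC X] have conj: "map_mat cnj X = X"
    unfolding map_mat_cnj_cmat sol by simp
  define Y where "Y = map_mat Re X"
  have XY: "X = cmat Y"
  proof (rule eq_matI)
    fix i j assume "i < dim_row (cmat Y)" "j < dim_col (cmat Y)"
    then have ij: "i < dim_row X" "j < dim_col X" by (auto simp: Y_def)
    have "cnj (X $$ (i, j)) = X $$ (i, j)"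
      using arg_cong[OF conj, of "\<lambda>M. M $$ (i, j)"] ij by simp
    then show "X $$ (i, j) = cmat Y $$ (i, j)"
      using ij by (simp add: Y_def complex_eq_iff)
  qed (auto simp: Y_def)
  have hom: "comm_ring_hom complex_of_real" by unfold_locales
  have Yc: "Y \<in> carrier_mat n n" using Xc by (simp add: Y_def)
  have YT: "Y\<^sup>T \<in> carrier_mat n n" using Yc by simp
  have "cmat Y = cmat A * (cmat Y)\<^sup>T * cmat B + cmat C"
    using T_Stein_solutionsD(2)[OF X] unfolding XY .
  also have "\<dots> = cmat (A * Y\<^sup>T * B) + cmat C"
    using A B YT by (simp add: of_real_hom.mat_hom_mult[of _ n n _ n] map_mat_transpose)
  also have "\<dots> = cmat (A * Y\<^sup>T * B + C)"
    using A YT B C by (intro eq_matI) auto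
  finally have "Y = A * Y\<^sup>T * B + C" by (rule of_real_hom.mat_hom_inj)
  then have "Y \<in> T_Stein_solutions n A B C" by (rule T_Stein_solutionsI[OF Yc])
  moreover have "cmat Y' = X" if "Y' \<in> T_Stein_solutions n A B C" for Y'
    using map_mat_T_Stein_solution[OF hom A B C that] sol by simp
  ultimately show ?thesis using XY by blast
qed

section \<open>From the given pencil to the normalised form\<close>

lemma component_equations:
  fixes A B C :: "real mat" and U1 V1 U2 V2 T1 T2 :: "complex mat"
  assumes A: "A \<in> carrier_mat n n" and B: "B \<in> carrier_mat n n" and C: "C \<in> carrier_mat n n"
    and U1: "U1 \<in> carrier_mat n k" and V1: "V1 \<in> carrier_mat n k"
    and U2: "U2 \<in> carrier_mat n k" and V2: "V2 \<in> carrier_mat n k"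
    and T1: "T1 \<in> carrier_mat k k" and T2: "T2 \<in> carrier_mat k k"
    and M: "cmat (M_mat n A B C) * (U1 @\<^sub>r V1) = (U2 @\<^sub>r V2) * T1"
    and L: "cmat (L_mat n A B C) * (U1 @\<^sub>r V1) = (U2 @\<^sub>r V2) * T2"
  defines "G \<equiv> cmat (B * A\<^sup>T)" and "K \<equiv> cmat (C * A\<^sup>T)"
  shows "G * U1 = U2 * T1" "V1 = K * U1 + V2 * T1" "U1 = U2 * T2"
    "V2 * T2 = K\<^sup>T * U1 + G\<^sup>T * V1"
proof -
  have AT: "A\<^sup>T \<in> carrier_mat n n" and BT: "B\<^sup>T \<in> carrier_mat n n" and CT: "C\<^sup>T \<in> carrier_mat n n"
    using A B C by auto
  have G: "G \<in> carrier_mat n n" and K: "K \<in> carrier_mat n n"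
    using A B C by (auto simp: G_def K_def)
  then have GT: "G\<^sup>T \<in> carrier_mat n n" and KT: "K\<^sup>T \<in> carrier_mat n n" by auto
  have "A * B\<^sup>T = (B * A\<^sup>T)\<^sup>T" "A * C\<^sup>T = (C * A\<^sup>T)\<^sup>T"
    using transpose_mult[OF B AT] transpose_mult[OF C AT] by auto
  then have abt: "cmat (A * B\<^sup>T) = G\<^sup>T" and act: "cmat (A * C\<^sup>T) = K\<^sup>T"
    by (simp_all add: G_def K_def map_mat_transpose)
  have "cmat (M_mat n A B C) = four_block_mat G (0\<^sub>m n n) (- K) (1\<^sub>m n)"
    unfolding M_mat_def G_def K_def using A B C by (intro eq_matI) auto
  then have "(G * U1 + 0\<^sub>m n n * V1) @\<^sub>r (- K * U1 + 1\<^sub>m n * V1) = (U2 * T1) @\<^sub>r (V2 * T1)"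
    using M four_block_mat_mult_append_rows[of G n n "0\<^sub>m n n" n "- K" n "1\<^sub>m n" U1 k V1]
      append_rows_mult[OF U2 V2 T1] G K U1 V1 by simp
  then have m: "G * U1 + 0\<^sub>m n n * V1 = U2 * T1" "- K * U1 + 1\<^sub>m n * V1 = V2 * T1"
    by (rule append_rows_eqD[where n = n and m = n and k = k]; use G K U1 V1 U2 V2 T1 in auto)+
  show "G * U1 = U2 * T1" using m(1) G U1 V1 by simp
  have KU: "K * U1 \<in> carrier_mat n k" using K U1 by simp
  have "N + (- N + V1) = V1" if "N \<in> carrier_mat n k" for N
    using that V1 by (intro eq_matI) auto
  from this[OF KU] have "V1 = K * U1 + (- (K * U1) + V1)" ..
  also have "- (K * U1) + V1 = V2 * T1" using m(2) K U1 V1 by simp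
  finally show "V1 = K * U1 + V2 * T1" .
  have "cmat (L_mat n A B C) = four_block_mat (1\<^sub>m n) (0\<^sub>m n n) K\<^sup>T G\<^sup>T"
    unfolding L_mat_def act[symmetric] abt[symmetric] using A B C by (intro eq_matI) auto
  then have "(1\<^sub>m n * U1 + 0\<^sub>m n n * V1) @\<^sub>r (K\<^sup>T * U1 + G\<^sup>T * V1) = (U2 * T2) @\<^sub>r (V2 * T2)"
    using L four_block_mat_mult_append_rows[of "1\<^sub>m n" n n "0\<^sub>m n n" n "K\<^sup>T" n "G\<^sup>T" U1 k V1]
      append_rows_mult[OF U2 V2 T2] GT KT U1 V1 by simp
  then have l: "1\<^sub>m n * U1 + 0\<^sub>m n n * V1 = U2 * T2" "K\<^sup>T * U1 + G\<^sup>T * V1 = V2 * T2"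
    by (rule append_rows_eqD[where n = n and m = n and k = k]; use GT KT U1 V1 U2 V2 T2 in auto)+
  show "U1 = U2 * T2" using l(1) U1 V1 by simp
  show "V2 * T2 = K\<^sup>T * U1 + G\<^sup>T * V1" using l(2) by simp
qed

lemma append_rows_full_rank_cancel:
  fixes U V :: "'a :: field mat"
  assumes U: "U \<in> carrier_mat n k" and V: "V \<in> carrier_mat n k"
    and rk: "vec_space.rank (2 * n) (U @\<^sub>r V) = k"
    and M: "M \<in> carrier_mat k l" and z: "U * M = 0\<^sub>m n l" "V * M = 0\<^sub>m n l"
  shows "M = 0\<^sub>m k l"
proof (rule full_column_rank_cancel[OF _ rk M])
  show "U @\<^sub>r V \<in> carrier_mat (2 * n) k" using carrier_append_rows[OF U V] by (simp add: mult_2)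
  show "(U @\<^sub>r V) * M = 0\<^sub>m (2 * n) l"
    unfolding append_rows_mult[OF U V M] z by (simp add: append_rows_zero mult_2)
qed

lemma pencil_equivE:
  assumes eq: "pencil_equiv T1 T2 G (1\<^sub>m n)"
    and T: "T1 \<in> carrier_mat k k" "T2 \<in> carrier_mat k k" and G: "G \<in> carrier_mat n n"
  obtains P Q where "k = n" "P \<in> carrier_mat n n" "Q \<in> carrier_mat n n"
    "det P \<noteq> 0" "det Q \<noteq> 0" "P * T1 * Q = G" "P * T2 * Q = 1\<^sub>m n"
proof -
  obtain P Q where P: "P \<in> carrier_mat k k" and Q: "Q \<in> carrier_mat k k"
    and inv: "invertible_mat P" "invertible_mat Q"
    and e: "\<And>\<mu>. P * (T1 - \<mu> \<cdot>\<^sub>m T2) * Q = G - \<mu> \<cdot>\<^sub>m 1\<^sub>m n"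
    using eq T unfolding pencil_equiv_def by auto
  have kn: "k = n" using arg_cong[OF e[of 0], of dim_row] P by simp
  \<comment> \<open>Evaluating the equivalence at \<open>\<mu> = 0\<close> and \<open>\<mu> = 1\<close> determines both coefficients.\<close>
  have "T1 - 0 \<cdot>\<^sub>m T2 = T1" "G - 0 \<cdot>\<^sub>m 1\<^sub>m n = G"
    using T G by (auto intro!: eq_matI)
  then have e0: "P * T1 * Q = G" using e[of 0] by simp
  have PT: "P * T1 * Q \<in> carrier_mat n n" "P * T2 * Q \<in> carrier_mat n n" using P Q T kn by auto
  have "1 \<cdot>\<^sub>m T2 = T2" by (intro eq_matI) auto
  then have "P * (T1 - 1 \<cdot>\<^sub>m T2) * Q = (P * T1 - P * T2) * Q"
    using P T by (simp add: mult_minus_distrib_mat[of P k k _ k])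
  also have "\<dots> = P * T1 * Q - P * T2 * Q"
    using P Q T by (intro minus_mult_distrib_mat[of _ k k]) auto
  finally have e1: "G - P * T2 * Q = G - 1 \<cdot>\<^sub>m 1\<^sub>m n" using e[of 1] e0 by simp
  have "P * T2 * Q = 1\<^sub>m n"
  proof (rule eq_matI)
    fix i j assume "i < dim_row (1\<^sub>m n :: complex mat)" "j < dim_col (1\<^sub>m n :: complex mat)"
    then have ij: "i < n" "j < n" by auto
    have "(G - P * T2 * Q) $$ (i, j) = G $$ (i, j) - (P * T2 * Q) $$ (i, j)"
      using ij PT(2) by (intro index_minus_mat) auto
    moreover have "(G - 1 \<cdot>\<^sub>m 1\<^sub>m n) $$ (i, j) = G $$ (i, j) - 1\<^sub>m n $$ (i, j)"
      using ij by simp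
    ultimately show "(P * T2 * Q) $$ (i, j) = 1\<^sub>m n $$ (i, j)" using e1 by simp
  qed (use PT in auto)
  with that kn P Q inv e0 show thesis by (simp add: invertible_mat_iff_det_nonzero)
qed

text \<open>
  The change of bases \<open>U1 Q, V1 Q\<close> and \<open>U2 P\<^sup>-\<^sup>1, V2 P\<^sup>-\<^sup>1\<close> reduces the pencil to \<open>G - \<lambda> I\<close>; it
  makes the upper blocks equal because \<open>U1 Q = U2 T2 Q = U2 P\<^sup>-\<^sup>1\<close>.  The conclusion is stated with
  \<open>V U1 = V1\<close> and \<open>V\<^sup>T U2 = V2\<close>, from which both quotient formulas are read off.
\<close>

lemma quotient_solves_affine_T_equation:
  fixes G K U1 V1 U2 V2 T1 T2 :: "complex mat"
  assumes G: "G \<in> carrier_mat n n" and K: "K \<in> carrier_mat n n"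
    and U1: "U1 \<in> carrier_mat n n" and V1: "V1 \<in> carrier_mat n n"
    and U2: "U2 \<in> carrier_mat n n" and V2: "V2 \<in> carrier_mat n n"
    and T1: "T1 \<in> carrier_mat n n" and T2: "T2 \<in> carrier_mat n n"
    and eqs: "G * U1 = U2 * T1" "V1 = K * U1 + V2 * T1" "U1 = U2 * T2"
      "V2 * T2 = K\<^sup>T * U1 + G\<^sup>T * V1"
    and rk: "vec_space.rank (2 * n) (U2 @\<^sub>r V2) = n"
    and free: "T_reciprocal_free (spectrum G)"
    and P: "P \<in> carrier_mat n n" and Q: "Q \<in> carrier_mat n n"
    and dP: "det P \<noteq> 0" and dQ: "det Q \<noteq> 0"
    and PTQ: "P * T1 * Q = G" "P * T2 * Q = 1\<^sub>m n"
  obtains V where "V \<in> carrier_mat n n" "det U1 \<noteq> 0" "det U2 \<noteq> 0"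
    "V * U1 = V1" "V\<^sup>T * U2 = V2" "V = K + V\<^sup>T * G"
proof -
  note as = assoc_mult_mat[of _ n n _ n _ n]
  define R where "R = mat_inv P"
  have R: "R \<in> carrier_mat n n" and PR: "P * R = 1\<^sub>m n" and RP: "R * P = 1\<^sub>m n"
    using mat_inv_inverts[OF P dP] by (auto simp: R_def)
  have TQ: "T1 * Q = R * G" "T2 * Q = R"
  proof -
    have "T1 * Q = R * (P * T1 * Q)" "T2 * Q = R * (P * T2 * Q)"
      using R P T1 T2 Q by (simp_all add: as[symmetric] RP del: assoc_mult_mat)
    then show "T1 * Q = R * G" "T2 * Q = R" using PTQ R by auto
  qed
  define W where "W = U2 * R"
  define Y where "Y = V1 * Q"
  define Z where "Z = V2 * R"
  have W: "W \<in> carrier_mat n n" and Y: "Y \<in> carrier_mat n n" and Z: "Z \<in> carrier_mat n n"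
    using U2 V1 V2 R Q by (auto simp: W_def Y_def Z_def)
  have UQ: "U1 * Q = W"
    unfolding W_def eqs(3) using U2 T2 Q by (simp add: as TQ)
  have GT: "G\<^sup>T \<in> carrier_mat n n" and KT: "K\<^sup>T \<in> carrier_mat n n" using G K by auto
  have comm: "G * W = W * G"
  proof -
    have "G * W = G * U1 * Q" unfolding UQ[symmetric] using G U1 Q by (simp add: as)
    also have "\<dots> = U2 * (T1 * Q)" unfolding eqs(1) using U2 T1 Q by (simp add: as)
    also have "\<dots> = W * G" unfolding TQ W_def using U2 R G by (simp add: as)
    finally show ?thesis .
  qed
  have Yeq: "Y = K * W + Z * G"
  proof -
    have "Y = (K * U1 + V2 * T1) * Q" unfolding Y_def using eqs(2) by (rule arg_cong)
    also have "\<dots> = K * U1 * Q + V2 * T1 * Q"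
      using K U1 V2 T1 Q by (intro add_mult_distrib_mat) auto
    also have "K * U1 * Q = K * W" unfolding UQ[symmetric] using K U1 Q by (simp add: as)
    also have "V2 * T1 * Q = Z * G" using V2 T1 Q R G by (simp add: as TQ Z_def)
    finally show ?thesis .
  qed
  have Zeq: "Z = K\<^sup>T * W + G\<^sup>T * Y"
  proof -
    have "Z = V2 * T2 * Q" using V2 T2 Q by (simp add: as TQ Z_def)
    also have "\<dots> = K\<^sup>T * U1 * Q + G\<^sup>T * V1 * Q"
      unfolding eqs(4) using KT U1 GT V1 Q by (intro add_mult_distrib_mat) auto
    also have "K\<^sup>T * U1 * Q = K\<^sup>T * W" unfolding UQ[symmetric] using KT U1 Q by (simp add: as)
    also have "G\<^sup>T * V1 * Q = G\<^sup>T * Y" unfolding Y_def using GT V1 Q by (simp add: as)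
    finally show ?thesis .
  qed
  have inj: "M = 0\<^sub>m n 1" if M: "M \<in> carrier_mat n 1" "W * M = 0\<^sub>m n 1" "Z * M = 0\<^sub>m n 1" for M
  proof -
    have RM: "R * M \<in> carrier_mat n 1" using R M by simp
    have "R * M = 0\<^sub>m n 1"
      by (rule append_rows_full_rank_cancel[OF U2 V2 rk RM])
        (use M U2 V2 R in \<open>auto simp: W_def Z_def\<close>)
    moreover have "det R \<noteq> 0" by (rule det_nonzero_if_left_inverse[OF R P PR])
    ultimately show ?thesis using mult_left_cancel_zero[OF R _ M(1)] by simp
  qed
  have dW: "det W \<noteq> 0"
    by (rule deflating_block_nonsingular[OF G K W Y Z free comm Yeq Zeq inj])
  obtain V where V: "V \<in> carrier_mat n n" and VW: "V * W = Y" "V\<^sup>T * W = Z"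
    and VG: "V = K + V\<^sup>T * G"
    by (rule deflating_block_quotient[OF G K W Y Z free comm Yeq Zeq dW])
  have VT: "V\<^sup>T \<in> carrier_mat n n" using V by simp
  have "det U1 \<noteq> 0" using dW det_mult[OF U1 Q] unfolding UQ by auto
  moreover have "det U2 \<noteq> 0" using dW det_mult[OF U2 R] unfolding W_def by auto
  moreover have "V * U1 = V1"
  proof (rule mult_right_cancel[OF Q dQ])
    show "V * U1 * Q = V1 * Q" using V U1 Q VW(1) by (simp add: as UQ Y_def)
  qed (use V U1 V1 in auto)
  moreover have "V\<^sup>T * U2 = V2"
  proof (rule mult_right_cancel[OF R])
    show "det R \<noteq> 0" by (rule det_nonzero_if_left_inverse[OF R P PR])
    show "V\<^sup>T * U2 * R = V2 * R" using VT U2 R VW(2) by (simp add: as W_def Z_def)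
  qed (use VT U2 V2 in auto)
  ultimately show thesis using that V VG by blast
qed

lemma mult_mat_inv_eq:
  fixes V :: "'a :: field mat"
  assumes "V \<in> carrier_mat n n" "U \<in> carrier_mat n n" "det U \<noteq> 0" "V * U = Y"
  shows "Y * mat_inv U = V"
proof -
  have "Y * mat_inv U = V * (U * mat_inv U)"
    unfolding assms(4)[symmetric] using assms(1,2) mat_inv_inverts(1)[OF assms(2,3)]
    by (rule assoc_mult_mat)
  then show ?thesis using assms(1) mat_inv_inverts(2)[OF assms(2,3)] by simp
qed

theorem theorem3p2:
  fixes n k :: nat
    and A B C :: "real mat"
    and U1 V1 U2 V2 T1 T2 :: "complex mat"
  assumes "A \<in> carrier_mat n n" "B \<in> carrier_mat n n" "C \<in> carrier_mat n n"
    and "U1 \<in> carrier_mat n k" "V1 \<in> carrier_mat n k"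
    and "U2 \<in> carrier_mat n k" "V2 \<in> carrier_mat n k"
    and "T1 \<in> carrier_mat k k" "T2 \<in> carrier_mat k k"
    and "cmat (M_mat n A B C) * (U1 @\<^sub>r V1) = (U2 @\<^sub>r V2) * T1"
    and "cmat (L_mat n A B C) * (U1 @\<^sub>r V1) = (U2 @\<^sub>r V2) * T2"
    and "vec_space.rank (2 * n) (U1 @\<^sub>r V1) = k"
    and "vec_space.rank (2 * n) (U2 @\<^sub>r V2) = k"
    and "T_reciprocal_free (spectrum (cmat (B * A\<^sup>T)))"
  shows "(pencil_spectrum T1 T2 = pencil_spectrum (1\<^sub>m n) (cmat (A * B\<^sup>T)) \<longrightarrow>
            U1 = 0\<^sub>m n k \<and> U2 = 0\<^sub>m n k) \<and>
         (pencil_equiv T1 T2 (cmat (B * A\<^sup>T)) (1\<^sub>m n) \<longrightarrow>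
            k = n \<and> invertible_mat U1 \<and> invertible_mat U2 \<and>
            (invertible_mat A \<longrightarrow>
              (let X = V1 * mat_inv U1 * cmat ((mat_inv A)\<^sup>T)
               in X = (mat_inv U2)\<^sup>T * V2\<^sup>T * cmat ((mat_inv A)\<^sup>T) \<and>
                  T_Stein_solutions n (cmat A) (cmat B) (cmat C) = {X} \<and>
                  cmat ` T_Stein_solutions n A B C = {X})))"
proof (intro conjI impI)
  note dims = assms(1-9)
  note A = dims(1) and B = dims(2) and C = dims(3)
  define G where "G = cmat (B * A\<^sup>T)"
  define K where "K = cmat (C * A\<^sup>T)"
  have G: "G \<in> carrier_mat n n" and K: "K \<in> carrier_mat n n"
    using A B C by (auto simp: G_def K_def)
  have free: "T_reciprocal_free (spectrum G)" using assms(14) by (simp add: G_def)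
  note eqs = component_equations[OF dims assms(10,11), folded G_def K_def]
  {
    assume sp: "pencil_spectrum T1 T2 = pencil_spectrum (1\<^sub>m n) (cmat (A * B\<^sup>T))"
    have "cmat (A * B\<^sup>T) = G\<^sup>T"
      using transpose_mult[of B n n "A\<^sup>T" n] A B by (simp add: G_def map_mat_transpose)
    then have "det (1\<^sub>m n - \<mu> \<cdot>\<^sub>m G\<^sup>T) = 0 \<longleftrightarrow> det (T1 - \<mu> \<cdot>\<^sub>m T2) = 0" for \<mu>
      using arg_cong[OF sp, of "\<lambda>S. Finite \<mu> \<in> S"] by (auto simp: pencil_spectrum_def split: if_splits)
    then have reg: "det (T1 - \<mu> \<cdot>\<^sub>m T2) \<noteq> 0" if "\<mu> \<in> spectrum G" for \<mu>
      using reciprocal_free_det_nonzero[OF G free that] det_reciprocal_pencil_transpose[OF G] by simp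
    have "G * U2 * T2 = U2 * T1"
      using eqs(1,3) G dims(6,9) by simp
    then have U2: "U2 = 0\<^sub>m n k"
      by (rule generalized_Sylvester_zero[OF G dims(6,8,9) _ reg])
    moreover have "U1 = 0\<^sub>m n k" using eqs(3) U2 dims(9) by simp
    ultimately show "U1 = 0\<^sub>m n k" "U2 = 0\<^sub>m n k" by auto
  next
    assume "pencil_equiv T1 T2 (cmat (B * A\<^sup>T)) (1\<^sub>m n)"
    then have "pencil_equiv T1 T2 G (1\<^sub>m n)" by (simp add: G_def)
    then obtain P Q where kn: "k = n" and PQ: "P \<in> carrier_mat n n" "Q \<in> carrier_mat n n"
      "det P \<noteq> 0" "det Q \<noteq> 0" "P * T1 * Q = G" "P * T2 * Q = 1\<^sub>m n"
      using pencil_equivE[OF _ dims(8,9) G] by metis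
    note dims' = dims[unfolded kn]
    obtain V where V: "V \<in> carrier_mat n n" and d: "det U1 \<noteq> 0" "det U2 \<noteq> 0"
      and VU: "V * U1 = V1" "V\<^sup>T * U2 = V2" and VG: "V = K + V\<^sup>T * G"
      by (rule quotient_solves_affine_T_equation[OF G K dims'(4-9) eqs assms(13)[unfolded kn] free PQ])
    show "k = n" by (rule kn)
    show "invertible_mat U1" "invertible_mat U2"
      using d dims'(4,6) by (simp_all add: invertible_mat_iff_det_nonzero)
    assume "invertible_mat A"
    then have dA: "det A \<noteq> 0" using A by (simp add: invertible_mat_iff_det_nonzero)
    note iA = mat_inv_inverts[OF A dA]
    define J where "J = cmat (mat_inv A)\<^sup>T"
    have J: "J \<in> carrier_mat n n" using iA by (simp add: J_def)
    have cA: "cmat A \<in> carrier_mat n n" and cB: "cmat B \<in> carrier_mat n n"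
      and cC: "cmat C \<in> carrier_mat n n" and cAT: "(cmat A)\<^sup>T \<in> carrier_mat n n" using A B C by auto
    have inv: "cmat (mat_inv A) * cmat A = 1\<^sub>m n" "cmat A * cmat (mat_inv A) = 1\<^sub>m n"
      using iA A by (simp_all add: of_real_hom.mat_hom_mult[symmetric, of _ n n _ n] of_real_hom.mat_hom_one)
    have dcA: "det (cmat A) \<noteq> 0"
      by (rule det_nonzero_if_left_inverse[OF cA _ inv(1)]) (use iA in auto)
    have JA: "J * (cmat A)\<^sup>T = 1\<^sub>m n"
    proof -
      have "J * (cmat A)\<^sup>T = (cmat A * cmat (mat_inv A))\<^sup>T"
        unfolding J_def map_mat_transpose[symmetric] using cA iA(1) by (intro transpose_mult[symmetric]) auto
      then show ?thesis using inv(2) by simp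
    qed
    define X where "X = V * J"
    have X: "X \<in> carrier_mat n n" using V J by (simp add: X_def)
    have XA: "X * (cmat A)\<^sup>T = V" unfolding X_def using V J cAT by (simp add: JA)
    have Geq: "cmat B * (cmat A)\<^sup>T = G" and Keq: "cmat C * (cmat A)\<^sup>T = K"
      unfolding G_def K_def using A B C
      by (simp_all add: of_real_hom.mat_hom_mult[of _ n n _ n] map_mat_transpose)
    have Xsol: "X \<in> T_Stein_solutions n (cmat A) (cmat B) (cmat C)"
      unfolding T_Stein_solutions_iff[OF cA dcA cB cC X] XA Geq Keq by (rule VG)
    have free': "T_reciprocal_free (spectrum (cmat B * (cmat A)\<^sup>T))" unfolding Geq by (rule free)
    have sols: "T_Stein_solutions n (cmat A) (cmat B) (cmat C) = {X}"
      using Xsol T_Stein_solution_unique[OF cA dcA cB cC free'] by blast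
    have X1: "V1 * mat_inv U1 * J = X"
      using mult_mat_inv_eq[OF V dims'(4) d(1) VU(1)] by (simp add: X_def)
    have "V2 * mat_inv U2 = V\<^sup>T"
      using mult_mat_inv_eq[OF _ dims'(6) d(2) VU(2)] V by simp
    then have "(mat_inv U2)\<^sup>T * V2\<^sup>T = V"
      using transpose_mult[OF dims'(7) mat_inv_inverts(1)[OF dims'(6) d(2)]] by simp
    then have X2: "(mat_inv U2)\<^sup>T * V2\<^sup>T * J = X" by (simp add: X_def)
    show "let X = V1 * mat_inv U1 * cmat ((mat_inv A)\<^sup>T)
      in X = (mat_inv U2)\<^sup>T * V2\<^sup>T * cmat ((mat_inv A)\<^sup>T) \<and>
         T_Stein_solutions n (cmat A) (cmat B) (cmat C) = {X} \<and>
         cmat ` T_Stein_solutions n A B C = {X}"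
      unfolding J_def[symmetric] Let_def X1 X2
      using sols real_T_Stein_solutions[OF A B C sols] by simp
  }
qed

end
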